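(* Let $X_N=\{\mathbf{x}_1,\dots,\mathbf{x}_N\}\subseteq\mathbb{S}^2$ be a set of $N$ distinct points. The Voronoi partition $\mathcal{V}$ of $X_N$ is an $X_N$-compatible partition of $\mathbb{S}^2$ and is $2$-optimal for the minimum norm $X_N$-compatible partition problem $R^*(X_N):=\inf_{\mathcal{R}\in\mathcal{P}(X_N)}\|\mathcal{R}\|$, in the sense that $$R^*(X_N)\le\|\mathcal{V}\|\le2R^*(X_N).$$
   Context: $\mathbb{S}^2$ is the unit sphere in $\mathbb{R}^3$ with geodesic distance $\mathrm{dist}(\mathbf{x},\mathbf{y})=\arccos\langle\mathbf{x},\mathbf{y}\rangle$. A finite collection $\mathcal{R}=\{R_1,\dots,R_N\}$ of closed, nonoverlapping (i.e. having no common interior points) subsets with $\mathbb{S}^2=\bigcup_{j=1}^NR_j$ is called a partition of $\mathbb{S}^2$. It is $X_N$-compatible if each patch $R_j$ contains exactly one point $\mathbf{x}_j\in X_N$ in its interior. $\mathcal{P}(X_N)$ is the family of all $X_N$-compatible partitions. The partition norm is $\|\mathcal{R}\|:=\max_{R_j\in\mathcal{R}}\mathrm{diam}\,R_j$, where $\mathrm{diam}\,S:=\sup_{\mathbf{x},\mathbf{y}\in S}\mathrm{dist}(\mathbf{x},\mathbf{y})$. The Voronoi partition is $\mathcal{V}=\{V_j\}_{j=1}^N$ with $V_j:=\{\mathbf{x}\in\mathbb{S}^2:\mathrm{dist}(\mathbf{x},\mathbf{x}_j)\le\mathrm{dist}(\mathbf{x},\mathbf{x}_i),\ i=1,\dots,N\}$.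 *)

theory Defs
  imports "HOL-Analysis.Analysis"
begin

abbreviation S2 :: "(real^3) set" where
  "S2 \<equiv> sphere 0 1"

definition gdist :: "real^3 \<Rightarrow> real^3 \<Rightarrow> real" where
  "gdist x y = arccos (x \<bullet> y)"

text \<open>\<^term>\<open>gdist\<close> is bounded on the sphere, so the real supremum is the
  intended one for every nonempty \<open>A \<subseteq> S2\<close>; patches of compatible partitions are nonempty.\<close>

definition gdiam :: "(real^3) set \<Rightarrow> real" where
  "gdiam A = (SUP (x, y)\<in>A \<times> A. gdist x y)"

text \<open>``Closed'' and ``interior'' refer to the topology of the sphere: every subset of
  \<^term>\<open>S2\<close> has empty interior in the ambient space.\<close>

definition sphere_interior :: "(real^3) set \<Rightarrow> (real^3) set" where
  "sphere_interior A = (top_of_set S2) interior_of A"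

definition sphere_partition :: "(real^3) set set \<Rightarrow> bool" where
  "sphere_partition \<R> \<longleftrightarrow>
     finite \<R> \<and>
     (\<forall>A\<in>\<R>. closedin (top_of_set S2) A) \<and>
     (\<forall>A\<in>\<R>. \<forall>B\<in>\<R>. A \<noteq> B \<longrightarrow> sphere_interior A \<inter> sphere_interior B = {}) \<and>
     \<Union>\<R> = S2"

text \<open>A compatible partition has as many patches as there are points. Points
  of \<open>X\<close> on the boundary of a patch are not excluded: only the interior is constrained.\<close>

definition compatible_partitions :: "(real^3) set \<Rightarrow> (real^3) set set set" where
  "compatible_partitions X =
     {\<R>. sphere_partition \<R> \<and> card \<R> = card X \<and>
          (\<forall>A\<in>\<R>. \<exists>!x. x \<in> X \<and> x \<in> sphere_interior A)}"

definition partition_norm :: "(real^3) set set \<Rightarrow> real" where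
  "partition_norm \<R> = Max (gdiam ` \<R>)"

definition min_norm :: "(real^3) set \<Rightarrow> real" where
  "min_norm X = (INF \<R>\<in>compatible_partitions X. partition_norm \<R>)"

definition voronoi_cell :: "(real^3) set \<Rightarrow> real^3 \<Rightarrow> (real^3) set" where
  "voronoi_cell X p = {x \<in> S2. \<forall>q\<in>X. gdist x p \<le> gdist x q}"

definition voronoi :: "(real^3) set \<Rightarrow> (real^3) set set" where
  "voronoi X = voronoi_cell X ` X"

end

theory Submission
  imports Defs
begin

text \<open>On the sphere, \<open>gdist x p \<le> gdist x q\<close> means \<open>x \<bullet> q \<le> x \<bullet> p\<close>, so Voronoi cells are cut out by
  finitely many closed half-spaces, and two different cells overlap only in a great circle, which
  has no interior points. For \<open>2\<close>-optimality, let \<open>x\<close> lie in the cell of \<open>p\<close> and in the patch \<open>A\<close> of an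
  arbitrary compatible partition, and let \<open>q\<close> be the point of \<open>X\<close> inside \<open>A\<close>; then
  \<open>gdist x p \<le> gdist x q \<le> gdiam A\<close>. Hence every cell has radius at most the norm of the partition
  around its centre, and the triangle inequality bounds its diameter by twice that norm.\<close>

section \<open>Triangle inequality for angles between unit vectors\<close>

lemma norm_diff_projection_sq:
  fixes x y :: "'a::real_inner"
  assumes "norm x = 1" "norm y = 1"
  shows "(norm (x - (x \<bullet> y) *\<^sub>R y))\<^sup>2 = 1 - (x \<bullet> y)\<^sup>2"
proof -
  have "x \<bullet> x = 1" "y \<bullet> y = 1" using assms by (simp_all add: norm_eq_1)
  then show ?thesis
    unfolding power2_norm_eq_inner
    by (simp add: inner_diff_left inner_diff_right inner_commute power2_eq_square)
qed

text \<open>The components of \<open>x\<close> and \<open>z\<close> orthogonal to \<open>y\<close>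
  have lengths \<open>sin a\<close> and \<open>sin b\<close>, so by Cauchy-Schwarz their inner
  product is at least \<open>- (sin a * sin b)\<close>. Adding the product
  \<open>cos a * cos b\<close> of the components along \<open>y\<close> gives
  \<open>cos (a + b) \<le> x \<bullet> z\<close>, and arccos reverses the order.\<close>

lemma arccos_inner_triangle:
  fixes x y z :: "'a::real_inner"
  assumes x: "norm x = 1" and y: "norm y = 1" and z: "norm z = 1"
  shows "arccos (x \<bullet> z) \<le> arccos (x \<bullet> y) + arccos (y \<bullet> z)"
proof -
  have bound: "\<bar>u \<bullet> v\<bar> \<le> 1" if "norm u = 1" "norm v = 1" for u v :: 'a
    using Cauchy_Schwarz_ineq2[of u v] that by simp
  note b = bound[OF x y] bound[OF y z] bound[OF x z]
  define a b where "a = arccos (x \<bullet> y)" and "b = arccos (y \<bullet> z)"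
  have ab: "0 \<le> a" "a \<le> pi" "0 \<le> b" "b \<le> pi"
    using b unfolding a_def b_def by (auto intro!: arccos_lbound arccos_ubound)
  have "arccos (x \<bullet> z) \<le> a + b"
  proof (cases "a + b \<le> pi")
    case True
    define u v where "u = x - (x \<bullet> y) *\<^sub>R y" and "v = z - (z \<bullet> y) *\<^sub>R y"
    have "norm u = sin a"
      unfolding u_def a_def
      using norm_diff_projection_sq[OF x y] b(1)
      by (simp add: sin_arccos_abs real_sqrt_unique)
    moreover have "norm v = sin b"
      unfolding v_def b_def
      using norm_diff_projection_sq[OF z y] b(2)
      by (simp add: sin_arccos_abs real_sqrt_unique inner_commute)
    ultimately have "- (sin a * sin b) \<le> u \<bullet> v"
      using Cauchy_Schwarz_ineq2[of u v] by simp
    moreover have "u \<bullet> v = x \<bullet> z - (x \<bullet> y) * (y \<bullet> z)"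
      using y by (simp add: u_def v_def inner_diff_left inner_diff_right
          inner_commute norm_eq_1)
    ultimately have "cos (a + b) \<le> x \<bullet> z"
      using b by (simp add: cos_add a_def b_def cos_arccos_abs)
    then have "arccos (x \<bullet> z) \<le> arccos (cos (a + b))"
      using b(3) by (intro arccos_le_arccos) auto
    then show ?thesis using True ab by (simp add: arccos_cos)
  next
    \<comment> \<open>Beyond \<open>pi\<close> the bound is trivial, since arccos never exceeds
      \<open>pi\<close>; the first case needs \<open>a + b \<le> pi\<close> for arccos to invert
      cos.\<close>
    case False
    moreover have "arccos (x \<bullet> z) \<le> pi" using b(3) by (intro arccos_ubound) auto
    ultimately show ?thesis by simp
  qed
  then show ?thesis by (simp add: a_def b_def)
qed

section \<open>Geodesic distance, diameter and interior on the sphere\<close>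

lemma abs_inner_sphere_le_1:
  assumes "x \<in> S2" "y \<in> S2" shows "\<bar>x \<bullet> y\<bar> \<le> 1"
  using assms Cauchy_Schwarz_ineq2[of x y] by simp

lemma gdist_nonneg: "x \<in> S2 \<Longrightarrow> y \<in> S2 \<Longrightarrow> 0 \<le> gdist x y"
  using abs_inner_sphere_le_1[of x y] by (auto simp: gdist_def intro!: arccos_lbound)

lemma gdist_le_pi: "x \<in> S2 \<Longrightarrow> y \<in> S2 \<Longrightarrow> gdist x y \<le> pi"
  using abs_inner_sphere_le_1[of x y] by (auto simp: gdist_def intro!: arccos_ubound)

lemma gdist_commute: "gdist x y = gdist y x"
  by (simp add: gdist_def inner_commute)

lemma gdist_triangle:
  "x \<in> S2 \<Longrightarrow> y \<in> S2 \<Longrightarrow> z \<in> S2 \<Longrightarrow> gdist x z \<le> gdist x y + gdist y z"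
  by (simp add: gdist_def arccos_inner_triangle)

lemma gdist_le_iff:
  assumes "x \<in> S2" "p \<in> S2" "q \<in> S2"
  shows "gdist x p \<le> gdist x q \<longleftrightarrow> x \<bullet> q \<le> x \<bullet> p"
  using assms by (simp add: gdist_def arccos_le_mono abs_inner_sphere_le_1)

lemma gdist_le_gdiam:
  assumes "A \<subseteq> S2" "x \<in> A" "y \<in> A"
  shows "gdist x y \<le> gdiam A"
proof -
  have "bdd_above ((\<lambda>(x, y). gdist x y) ` (A \<times> A))"
    using assms(1) by (auto intro!: bdd_aboveI[of _ pi] gdist_le_pi)
  then show ?thesis
    unfolding gdiam_def using assms by (auto intro: cSUP_upper2[of _ _ "(x, y)"])
qed

lemma gdiam_le:
  assumes "A \<noteq> {}" "\<And>x y. x \<in> A \<Longrightarrow> y \<in> A \<Longrightarrow> gdist x y \<le> c"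
  shows "gdiam A \<le> c"
  unfolding gdiam_def using assms by (intro cSUP_least) auto

lemma sphere_interior_subset: "sphere_interior A \<subseteq> A"
  by (simp add: sphere_interior_def interior_of_subset)

lemma sphere_interiorI:
  assumes "open T" "x \<in> S2 \<inter> T" "S2 \<inter> T \<subseteq> A"
  shows "x \<in> sphere_interior A"
  using assms unfolding sphere_interior_def interior_of_def openin_open by blast

section \<open>The Voronoi cells form a compatible partition\<close>

lemma voronoi_cell_eq:
  assumes "X \<subseteq> S2" "p \<in> X"
  shows "voronoi_cell X p = S2 \<inter> (\<Inter>q\<in>X. {x. x \<bullet> q \<le> x \<bullet> p})"
  using assms by (auto simp: voronoi_cell_def gdist_le_iff subset_iff)

lemma closedin_voronoi_cell:
  assumes "X \<subseteq> S2" "p \<in> X"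
  shows "closedin (top_of_set S2) (voronoi_cell X p)"
  unfolding voronoi_cell_eq[OF assms]
  by (intro closedin_closed_Int closed_INT ballI closed_Collect_le continuous_intros)

lemma inner_sphere_less_1:
  assumes "p \<in> S2" "q \<in> S2" "p \<noteq> q"
  shows "p \<bullet> q < 1"
proof -
  have "0 < (p - q) \<bullet> (p - q)" using assms by simp
  also have "\<dots> = 2 - 2 * (p \<bullet> q)"
    using assms by (simp add: inner_diff_left inner_diff_right inner_commute norm_eq_1)
  finally show ?thesis by simp
qed

lemma in_interior_voronoi_cell:
  assumes "finite X" "X \<subseteq> S2" "p \<in> X"
  shows "p \<in> sphere_interior (voronoi_cell X p)"
proof (rule sphere_interiorI)
  \<comment> \<open>Making the inequalities strict gives open half-spaces; \<open>p\<close> itself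
    must be left out of the index set, where strictness would fail. A finite intersection stays
    open.\<close>
  let ?T = "\<Inter>q\<in>X - {p}. {x. x \<bullet> q < x \<bullet> p}"
  show "open ?T"
    using assms(1) by (intro open_INT ballI open_Collect_less continuous_intros) auto
  have "p \<bullet> p = 1" using assms by (auto simp: norm_eq_1)
  moreover have "p \<bullet> q < 1" if "q \<in> X - {p}" for q
    using that assms by (intro inner_sphere_less_1) auto
  ultimately show "p \<in> S2 \<inter> ?T" using assms by auto
  show "S2 \<inter> ?T \<subseteq> voronoi_cell X p"
    unfolding voronoi_cell_eq[OF assms(2,3)] by (auto simp: less_eq_real_def)
qed

lemma notin_voronoi_cell:
  assumes "X \<subseteq> S2" "p \<in> X" "q \<in> X" "p \<noteq> q"
  shows "q \<notin> voronoi_cell X p"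
proof
  assume "q \<in> voronoi_cell X p"
  then have "q \<bullet> q \<le> q \<bullet> p" using assms by (simp add: voronoi_cell_eq)
  moreover have "q \<bullet> q = 1" using assms by (auto simp: norm_eq_1 subset_iff)
  moreover have "q \<bullet> p < 1" using assms by (intro inner_sphere_less_1) auto
  ultimately show False by simp
qed

text \<open>Pushing a point of the circle along the normal \<open>v\<close> and renormalising leaves
  the circle at once, while small pushes stay in any given neighbourhood of the point.\<close>

lemma great_circle_interior_empty:
  assumes "v \<noteq> 0"
  shows "sphere_interior {x. x \<bullet> v = 0} = {}"
proof (rule equals0I)
  fix x assume "x \<in> sphere_interior {x. x \<bullet> v = 0}"
  then obtain T where T: "open T" "x \<in> T" "x \<in> S2" "S2 \<inter> T \<subseteq> {x. x \<bullet> v = 0}"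
    unfolding sphere_interior_def interior_of_def openin_open by blast
  have xv: "x \<bullet> v = 0" using T by auto
  define y where "y t = sgn (x + t *\<^sub>R v)" for t
  have y_inner: "y t \<bullet> v = t * (v \<bullet> v) / norm (x + t *\<^sub>R v)" for t
    by (simp add: y_def sgn_div_norm inner_add_left xv divide_inverse)
  \<comment> \<open>Since \<open>v\<close> is orthogonal to \<open>x\<close>, the inner product with
    \<open>x\<close> is 1 for every \<open>t\<close>, so renormalising is always possible.\<close>
  have nz: "x + t *\<^sub>R v \<noteq> 0" for t
  proof
    assume "x + t *\<^sub>R v = 0"
    then have "x \<bullet> x + t * (x \<bullet> v) = 0"
      by (metis inner_add_right inner_scaleR_right inner_zero_right)
    then show False using T(3) xv by (simp add: norm_eq_1)
  qed
  have "(y \<longlongrightarrow> sgn (x + 0 *\<^sub>R v)) (at 0)"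
    unfolding y_def using nz[of 0] by (intro tendsto_intros) auto
  then have "(y \<longlongrightarrow> x) (at 0)" using T(3) by (simp add: sgn_div_norm)
  then have "\<forall>\<^sub>F t in at 0. y t \<in> T" using T by (auto dest: topological_tendstoD)
  then have "\<forall>\<^sub>F t in at 0. y t \<in> T \<and> t \<noteq> 0"
    by (intro eventually_conj eventually_neq_at_within)
  then obtain t where "y t \<in> T" "t \<noteq> 0"
    using eventually_happens trivial_limit_at by blast
  moreover have "y t \<in> S2" using nz by (simp add: y_def norm_sgn)
  ultimately have "y t \<bullet> v = 0" using T(4) by blast
  then show False using \<open>t \<noteq> 0\<close> assms nz by (simp add: y_inner)
qed

text \<open>Interior commutes with binary intersection, and points shared by both cells are
  equidistant from \<open>p\<close> and \<open>q\<close>, hence orthogonal to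
  \<open>p - q\<close>.\<close>

lemma interior_voronoi_cells_disjoint:
  assumes "X \<subseteq> S2" "p \<in> X" "q \<in> X" "p \<noteq> q"
  shows "sphere_interior (voronoi_cell X p) \<inter> sphere_interior (voronoi_cell X q) = {}"
proof -
  have "voronoi_cell X p \<inter> voronoi_cell X q \<subseteq> {x. x \<bullet> (p - q) = 0}"
    using assms by (force simp: voronoi_cell_eq inner_diff_right)
  then have "sphere_interior (voronoi_cell X p \<inter> voronoi_cell X q)
      \<subseteq> sphere_interior {x. x \<bullet> (p - q) = 0}"
    unfolding sphere_interior_def by (rule interior_of_mono)
  then show ?thesis
    using great_circle_interior_empty[of "p - q"] assms(4)
    by (simp add: sphere_interior_def interior_of_Int)
qed

lemma Union_voronoi:
  assumes "finite X" "X \<noteq> {}"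
  shows "\<Union>(voronoi X) = S2"
proof
  show "\<Union>(voronoi X) \<subseteq> S2" by (auto simp: voronoi_def voronoi_cell_def)
  show "S2 \<subseteq> \<Union>(voronoi X)"
  proof
    fix x assume x: "x \<in> S2"
    obtain p where "p \<in> X" "\<forall>q\<in>X. gdist x p \<le> gdist x q"
      using arg_min_if_finite(1)[OF assms] arg_min_least[OF assms] by blast
    then show "x \<in> \<Union>(voronoi X)" using x by (auto simp: voronoi_def voronoi_cell_def)
  qed
qed

lemma voronoi_compatible:
  assumes "finite X" "X \<noteq> {}" "X \<subseteq> S2"
  shows "voronoi X \<in> compatible_partitions X"
proof -
  \<comment> \<open>Each point of \<open>X\<close> lies in its own cell and in no other, so distinct
    points have distinct cells; this yields the required number of patches.\<close>
  have inj: "inj_on (voronoi_cell X) X"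
    using in_interior_voronoi_cell[OF assms(1,3)] notin_voronoi_cell[OF assms(3)]
      sphere_interior_subset by (metis inj_onI subsetD)
  have "sphere_partition (voronoi X)"
    unfolding sphere_partition_def
    using assms closedin_voronoi_cell[OF assms(3)] Union_voronoi[OF assms(1,2)]
      interior_voronoi_cells_disjoint[OF assms(3)]
    by (simp add: voronoi_def) metis
  moreover have "card (voronoi X) = card X"
    by (simp add: voronoi_def card_image inj)
  moreover have "\<exists>!x. x \<in> X \<and> x \<in> sphere_interior (voronoi_cell X p)" if "p \<in> X" for p
    using that in_interior_voronoi_cell[OF assms(1,3)] notin_voronoi_cell[OF assms(3) that]
      sphere_interior_subset[of "voronoi_cell X p"] by blast
  ultimately show ?thesis
    by (auto simp: compatible_partitions_def voronoi_def)
qed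

section \<open>Covering radius of \<open>X\<close> and comparison with arbitrary compatible
  partitions\<close>

lemma compatible_dist_le_norm:
  assumes "\<R> \<in> compatible_partitions X" "x \<in> S2"
  obtains q where "q \<in> X" "gdist x q \<le> partition_norm \<R>"
proof -
  have fin: "finite \<R>" and un: "\<Union>\<R> = S2"
    and pt: "\<And>A. A \<in> \<R> \<Longrightarrow> \<exists>!q. q \<in> X \<and> q \<in> sphere_interior A"
    using assms(1) by (auto simp: compatible_partitions_def sphere_partition_def)
  obtain A where A: "A \<in> \<R>" "x \<in> A" using un assms(2) by blast
  obtain q where q: "q \<in> X" "q \<in> A" using pt[OF A(1)] sphere_interior_subset by blast
  have "gdist x q \<le> gdiam A" using A q un by (intro gdist_le_gdiam) auto
  also have "\<dots> \<le> partition_norm \<R>"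
    unfolding partition_norm_def using fin A by (intro Max_ge) auto
  finally show ?thesis using that q by blast
qed

lemma partition_norm_nonneg:
  assumes "\<R> \<in> compatible_partitions X" "X \<subseteq> S2"
  shows "0 \<le> partition_norm \<R>"
proof -
  \<comment> \<open>Any point of the sphere serves: its distance to a suitable point of
    \<open>X\<close> is nonnegative and at most the norm.\<close>
  have ax: "(axis 1 1 :: real^3) \<in> S2" by simp
  obtain q where q: "q \<in> X" "gdist (axis 1 1) q \<le> partition_norm \<R>"
    using compatible_dist_le_norm[OF assms(1) ax] by blast
  have "0 \<le> gdist (axis 1 1) q" using ax q(1) assms(2) by (intro gdist_nonneg) auto
  then show ?thesis using q(2) by simp
qed

lemma voronoi_norm_le:
  assumes "finite X" "X \<noteq> {}" "X \<subseteq> S2" "\<R> \<in> compatible_partitions X"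
  shows "partition_norm (voronoi X) \<le> 2 * partition_norm \<R>"
proof -
  have radius: "gdist x p \<le> partition_norm \<R>" if "x \<in> voronoi_cell X p" for x p
  proof -
    have "x \<in> S2" using that by (simp add: voronoi_cell_def)
    then obtain q where "q \<in> X" "gdist x q \<le> partition_norm \<R>"
      using compatible_dist_le_norm[OF assms(4)] by blast
    then show ?thesis using that by (force simp: voronoi_cell_def)
  qed
  have "gdiam (voronoi_cell X p) \<le> 2 * partition_norm \<R>" if p: "p \<in> X" for p
  proof (rule gdiam_le)
    \<comment> \<open>An upper bound for all distances bounds the real supremum only over a nonempty
      set.\<close>
    show "voronoi_cell X p \<noteq> {}"
      using in_interior_voronoi_cell[OF assms(1,3) p] sphere_interior_subset by blast
    fix x y assume xy: "x \<in> voronoi_cell X p" "y \<in> voronoi_cell X p"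
    then have "gdist x y \<le> gdist x p + gdist p y"
      using p assms(3) by (intro gdist_triangle) (auto simp: voronoi_cell_def)
    then show "gdist x y \<le> 2 * partition_norm \<R>"
      using radius[OF xy(1)] radius[OF xy(2)] by (simp add: gdist_commute)
  qed
  then show ?thesis
    unfolding partition_norm_def[of "voronoi X"] using assms(1,2) by (simp add: voronoi_def)
qed

theorem proposition5p8:
  fixes X :: "(real^3) set" and N :: nat
  assumes "N \<ge> 1" and "finite X" and "card X = N" and "X \<subseteq> S2"
  shows "voronoi X \<in> compatible_partitions X
       \<and> min_norm X \<le> partition_norm (voronoi X)
       \<and> partition_norm (voronoi X) \<le> 2 * min_norm X"
proof (intro conjI)
  have X: "X \<noteq> {}" using assms by auto
  show compat: "voronoi X \<in> compatible_partitions X"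
    using voronoi_compatible assms X by blast
  \<comment> \<open>A real infimum lies below its members only if the set is bounded below; 0 is a
    bound.\<close>
  have "bdd_below (partition_norm ` compatible_partitions X)"
    using partition_norm_nonneg[OF _ assms(4)] by (auto intro!: bdd_belowI[of _ 0])
  then show "min_norm X \<le> partition_norm (voronoi X)"
    unfolding min_norm_def using compat by (rule cINF_lower)
  \<comment> \<open>With the factor moved to the left, half the Voronoi norm is a lower bound for
    all competing norms, hence for their infimum; the Voronoi partition shows that competitors
    exist.\<close>
  have "partition_norm (voronoi X) / 2 \<le> min_norm X"
    unfolding min_norm_def
  proof (rule cINF_greatest)
    show "compatible_partitions X \<noteq> {}" using compat by blast
    fix \<R> assume "\<R> \<in> compatible_partitions X"
    then show "partition_norm (voronoi X) / 2 \<le> partition_norm \<R>"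
      using voronoi_norm_le[OF assms(2) X assms(4), of \<R>] by simp
  qed
  then show "partition_norm (voronoi X) \<le> 2 * min_norm X" by simp
qed

end
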